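(* Let $T=M\times_\Phi^qS$ be a tight twisted product. For any $\mathscr H^T$-class $H\times H'$ of $T$ (where $H$ is an $\mathscr H$-class of $M$ and $H'$ is an $\mathscr H$-class of $S$) we have $$\Gamma(H\times H')\cong\Gamma(H)\times\Gamma(H').$$
   Context: $S$ is a monoid (multiplicative, identity $1$); $M$ is a commutative monoid (additive, identity $0$); $q\in M$ is fixed; $\mathbb N=\{0,1,2,\dots\}$. A twisting of $S$ is a map $\Phi:S\times S\to\mathbb N$ with $\Phi(a,b)+\Phi(ab,c)=\Phi(a,bc)+\Phi(b,c)$ for all $a,b,c\in S$. It is tight if (a) for all $a,b\in S$ there is $a'\in S$ with $ab=a'b$ and $\Phi(a',b)=0$; and (b) for all $a,b\in S$ there is $b'\in S$ with $ab=ab'$ and $\Phi(a,b')=0$. The twisted product $M\times_\Phi^qS$ is the semigroup with underlying set $M\times S$ and product $(i,a)(j,b)=(i+j+\Phi(a,b)q,\,ab)$, where for $n\in\mathbb N$, $nq$ is the $n$-fold sum of $q$ in $M$ (and $0q=0$); it is called tight if $\Phi$ is tight (in which case it is a monoid with identity $(0,1)$). On a monoid $X$, $x\,\mathscr H\,y$ iff $Xx=Xy$ and $xX=yX$. The $\mathscr H$-classes of $T$ are exactly the sets $H\times H'$ with $H$ an $\mathscr H$-class of $M$ and $H'$ an $\mathscr H$-class of $S$. Schützenberger group: for an $\mathscr H$-class $H$ of a monoid $X$, let $P(H)=\{u\in X: Hu\cap H\neq\varnothing\}=\{u\in X:Hu=H\}$. Each $u\in P(H)$ determines a bijection $\rho_u:H\to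 H$, $a\mapsto au$, and $\Gamma(H)=\{\rho_u:u\in P(H)\}$ is a (simply transitive) group of permutations of $H$ under composition (permutations written to the right of their arguments and composed left to right), called the Schützenberger group of $H$. *)

theory Defs
  imports "HOL-Algebra.Group" "HOL-Algebra.Coset"
begin

definition H_rel :: "('a, 'x) monoid_scheme \<Rightarrow> ('a \<times> 'a) set" where
  "H_rel X = {(x, y). x \<in> carrier X \<and> y \<in> carrier X \<and>
     carrier X #>\<^bsub>X\<^esub> x = carrier X #>\<^bsub>X\<^esub> y \<and>
     x <#\<^bsub>X\<^esub> carrier X = y <#\<^bsub>X\<^esub> carrier X}"

definition H_classes :: "('a, 'x) monoid_scheme \<Rightarrow> 'a set set" where
  "H_classes X = carrier X // H_rel X"

definition twisting :: "('s, 'x) monoid_scheme \<Rightarrow> ('s \<Rightarrow> 's \<Rightarrow> nat) \<Rightarrow> bool" where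
  "twisting S \<Phi> \<longleftrightarrow>
     (\<forall>a\<in>carrier S. \<forall>b\<in>carrier S. \<forall>c\<in>carrier S.
        \<Phi> a b + \<Phi> (a \<otimes>\<^bsub>S\<^esub> b) c = \<Phi> a (b \<otimes>\<^bsub>S\<^esub> c) + \<Phi> b c)"

definition tight :: "('s, 'x) monoid_scheme \<Rightarrow> ('s \<Rightarrow> 's \<Rightarrow> nat) \<Rightarrow> bool" where
  "tight S \<Phi> \<longleftrightarrow>
     (\<forall>a\<in>carrier S. \<forall>b\<in>carrier S. \<exists>a'\<in>carrier S.
        a \<otimes>\<^bsub>S\<^esub> b = a' \<otimes>\<^bsub>S\<^esub> b \<and> \<Phi> a' b = 0) \<and>
     (\<forall>a\<in>carrier S. \<forall>b\<in>carrier S. \<exists>b'\<in>carrier S.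
        a \<otimes>\<^bsub>S\<^esub> b = a \<otimes>\<^bsub>S\<^esub> b' \<and> \<Phi> a b' = 0)"

text \<open>The commutative monoid \<open>M\<close> is written multiplicatively, so the \<open>n\<close>-fold sum \<open>n q\<close>
  is \<open>q [^] n\<close>.  The \<open>one\<close> field is an identity element when the twisting is tight;
  in general the product is only a semigroup.\<close>

definition twisted_product ::
  "('m, 'x) monoid_scheme \<Rightarrow> 'm \<Rightarrow> ('s, 'y) monoid_scheme \<Rightarrow> ('s \<Rightarrow> 's \<Rightarrow> nat) \<Rightarrow> ('m \<times> 's) monoid"
where
  "twisted_product M q S \<Phi> =
     \<lparr>carrier = carrier M \<times> carrier S,
      mult = (\<lambda>(i, a) (j, b). (i \<otimes>\<^bsub>M\<^esub> j \<otimes>\<^bsub>M\<^esub> (q [^]\<^bsub>M\<^esub> \<Phi> a b), a \<otimes>\<^bsub>S\<^esub> b)),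
      one = (\<one>\<^bsub>M\<^esub>, \<one>\<^bsub>S\<^esub>)\<rparr>"

definition right_stabilizers :: "('a, 'x) monoid_scheme \<Rightarrow> 'a set \<Rightarrow> 'a set" where
  "right_stabilizers X H = {u \<in> carrier X. (H #>\<^bsub>X\<^esub> u) \<inter> H \<noteq> {}}"

definition right_translation :: "('a, 'x) monoid_scheme \<Rightarrow> 'a set \<Rightarrow> 'a \<Rightarrow> 'a \<Rightarrow> 'a" where
  "right_translation X H u = (\<lambda>a\<in>H. a \<otimes>\<^bsub>X\<^esub> u)"

text \<open>Permutations act on the right and compose from left to right: the product of
  \<open>f\<close> and \<open>g\<close> applies \<open>f\<close> first.\<close>

definition schutzenberger_group :: "('a, 'x) monoid_scheme \<Rightarrow> 'a set \<Rightarrow> ('a \<Rightarrow> 'a) monoid" where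
  "schutzenberger_group X H =
     \<lparr>carrier = right_translation X H ` right_stabilizers X H,
      mult = (\<lambda>f g. compose H g f),
      one = (\<lambda>a\<in>H. a)\<rparr>"

end

theory Submission
  imports Defs
begin

text \<open>On a single \<open>\<H>\<close>-class \<open>H'\<close> of \<open>S\<close>, tightness forces \<open>\<Phi>(a, u)\<close> to be
  independent of \<open>a \<in> H'\<close>: writing \<open>b = c a\<close> with \<open>\<Phi>(c, a) = 0\<close>, the twisting identity gives
  \<open>\<Phi>(b, u) = \<Phi>(c, a u) + \<Phi>(a, u) \<ge> \<Phi>(a, u)\<close>, and the roles of \<open>a\<close> and \<open>b\<close> are symmetric.
  With \<open>n\<close> the common value, translation by \<open>(i, u)\<close> on \<open>H \<times> H'\<close> is therefore the product of
  translation by \<open>i + n q\<close> on \<open>H\<close> and translation by \<open>u\<close> on \<open>H'\<close>.  Conversely, tightness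
  replaces \<open>u\<close> by some \<open>u'\<close> with the same translation and \<open>\<Phi>(a, u') = 0\<close>, so every pair of
  translations arises.\<close>

section \<open>Classes of Green's relation \<H>\<close>

lemma equiv_H_rel: "equiv (carrier X) (H_rel X)"
  unfolding H_rel_def by (rule equivI) (auto simp: refl_on_def sym_def trans_def)

lemma H_class_subset: "H \<in> H_classes X \<Longrightarrow> H \<subseteq> carrier X"
  unfolding H_classes_def by (rule in_quotient_imp_subset[OF equiv_H_rel])

lemma H_class_nonempty: "H \<in> H_classes X \<Longrightarrow> H \<noteq> {}"
  unfolding H_classes_def by (rule in_quotient_imp_non_empty[OF equiv_H_rel])

lemma H_class_rel: "\<lbrakk>H \<in> H_classes X; x \<in> H; y \<in> H\<rbrakk> \<Longrightarrow> (x, y) \<in> H_rel X"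
  unfolding H_classes_def using in_quotient_imp_in_rel[OF equiv_H_rel, of H X x y] by simp

lemma H_class_closed: "\<lbrakk>H \<in> H_classes X; x \<in> H; (x, y) \<in> H_rel X\<rbrakk> \<Longrightarrow> y \<in> H"
  unfolding H_classes_def using in_quotient_imp_closed[OF equiv_H_rel, of H X x y] by simp

lemma mem_r_coset_iff: "y \<in> A #>\<^bsub>X\<^esub> x \<longleftrightarrow> (\<exists>c\<in>A. y = c \<otimes>\<^bsub>X\<^esub> x)"
  by (auto simp: r_coset_def)

lemma mem_l_coset_iff: "y \<in> x <#\<^bsub>X\<^esub> A \<longleftrightarrow> (\<exists>c\<in>A. y = x \<otimes>\<^bsub>X\<^esub> c)"
  by (auto simp: l_coset_def)

lemma right_stabilizers_iff:
  "u \<in> right_stabilizers X H \<longleftrightarrow> u \<in> carrier X \<and> (\<exists>h\<in>H. h \<otimes>\<^bsub>X\<^esub> u \<in> H)"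
  unfolding right_stabilizers_def r_coset_def by blast

lemma right_stabilizersI:
  "\<lbrakk>u \<in> carrier X; h \<in> H; h \<otimes>\<^bsub>X\<^esub> u \<in> H\<rbrakk> \<Longrightarrow> u \<in> right_stabilizers X H"
  unfolding right_stabilizers_iff by blast

section \<open>Divisibility and right translations in one monoid\<close>

context monoid
begin

lemma principal_left_ideal_mono:
  assumes "x = c \<otimes> y" "c \<in> carrier G" "y \<in> carrier G"
  shows "carrier G #> x \<subseteq> carrier G #> y"
proof
  fix z assume "z \<in> carrier G #> x"
  then obtain d where d: "d \<in> carrier G" "z = d \<otimes> x" unfolding mem_r_coset_iff by blast
  then have "z = (d \<otimes> c) \<otimes> y" using assms by (simp add: m_assoc)
  then show "z \<in> carrier G #> y" using d(1) assms(2) unfolding mem_r_coset_iff by blast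
qed

lemma principal_right_ideal_mono:
  assumes "x = y \<otimes> c" "c \<in> carrier G" "y \<in> carrier G"
  shows "x <# carrier G \<subseteq> y <# carrier G"
proof
  fix z assume "z \<in> x <# carrier G"
  then obtain d where d: "d \<in> carrier G" "z = x \<otimes> d" unfolding mem_l_coset_iff by blast
  then have "z = y \<otimes> (c \<otimes> d)" using assms by (simp add: m_assoc)
  then show "z \<in> y <# carrier G" using d(1) assms(2) unfolding mem_l_coset_iff by blast
qed

text \<open>Mutual divisibility on both sides is the working form of the relation: it replaces
  equality of principal ideals by explicit factors.\<close>

lemma H_relI:
  assumes "x \<in> carrier G" "y \<in> carrier G"
    and "\<exists>c\<in>carrier G. x = c \<otimes> y" "\<exists>c\<in>carrier G. y = c \<otimes> x"
    and "\<exists>c\<in>carrier G. x = y \<otimes> c" "\<exists>c\<in>carrier G. y = x \<otimes> c"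
  shows "(x, y) \<in> H_rel G"
proof -
  have "carrier G #> x = carrier G #> y"
    using assms(1-4) by (auto del: subsetI intro!: equalityI intro: principal_left_ideal_mono)
  moreover have "x <# carrier G = y <# carrier G"
    using assms(1,2,5,6) by (auto del: subsetI intro!: equalityI intro: principal_right_ideal_mono)
  ultimately show ?thesis using assms(1,2) by (simp add: H_rel_def)
qed

lemma H_rel_left_factor:
  assumes "(x, y) \<in> H_rel G"
  obtains c where "c \<in> carrier G" "y = c \<otimes> x"
proof -
  have "y = \<one> \<otimes> y" using assms by (auto simp: H_rel_def)
  then have "y \<in> carrier G #> y" unfolding mem_r_coset_iff by blast
  then have "y \<in> carrier G #> x" using assms by (simp add: H_rel_def)
  then show thesis using that unfolding mem_r_coset_iff by blast
qed

lemma H_rel_right_factor: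
  assumes "(x, y) \<in> H_rel G"
  obtains c where "c \<in> carrier G" "y = x \<otimes> c"
proof -
  have "y = y \<otimes> \<one>" using assms by (auto simp: H_rel_def)
  then have "y \<in> y <# carrier G" unfolding mem_l_coset_iff by blast
  then have "y \<in> x <# carrier G" using assms by (simp add: H_rel_def)
  then show thesis using that unfolding mem_l_coset_iff by blast
qed

lemma H_class_left_factor:
  assumes "H \<in> H_classes G" "x \<in> H" "y \<in> H"
  obtains c where "c \<in> carrier G" "y = c \<otimes> x"
  using H_rel_left_factor[OF H_class_rel[OF assms]] .

lemma H_class_right_factor:
  assumes "H \<in> H_classes G" "x \<in> H" "y \<in> H"
  obtains c where "c \<in> carrier G" "y = x \<otimes> c"
  using H_rel_right_factor[OF H_class_rel[OF assms]] .

text \<open>Writing \<open>b = c \<otimes> a\<close>, left multiplication by \<open>c\<close>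
  carries the equation at \<open>a\<close> to \<open>b\<close>. Hence a right translation of an
  \<H>-class is determined by its value at one point.\<close>

lemma H_class_translation_eq:
  assumes H: "H \<in> H_classes G" and a: "a \<in> H" and b: "b \<in> H"
    and uv: "u \<in> carrier G" "v \<in> carrier G" and eq: "a \<otimes> u = a \<otimes> v"
  shows "b \<otimes> u = b \<otimes> v"
proof -
  obtain c where "c \<in> carrier G" "b = c \<otimes> a" using H_class_left_factor[OF H a b] .
  then show ?thesis using eq uv a H_class_subset[OF H] by (auto simp: m_assoc)
qed

text \<open>This is the step from \<open>Hu\<close> meeting \<open>H\<close> to \<open>Hu\<close>
  lying inside \<open>H\<close>. Left factors commute with right multiplication by \<open>u\<close>,
  so what happens at the one point \<open>h\<close> is transported to every \<open>x\<close> of the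
  class.\<close>

lemma right_stabilizers_mult_closed:
  assumes H: "H \<in> H_classes G" and u: "u \<in> right_stabilizers G H" and x: "x \<in> H"
  shows "x \<otimes> u \<in> H"
proof -
  obtain h where h: "h \<in> H" "h \<otimes> u \<in> H" and uc: "u \<in> carrier G"
    using u unfolding right_stabilizers_iff by blast
  have hc: "h \<in> carrier G" and xc: "x \<in> carrier G" using h x H_class_subset[OF H] by auto
  obtain c where c: "c \<in> carrier G" "x = c \<otimes> h" using H_class_left_factor[OF H h(1) x] .
  obtain d where d: "d \<in> carrier G" "h \<otimes> u = d \<otimes> x" using H_class_left_factor[OF H x h(2)] .
  obtain e where e: "e \<in> carrier G" "x = e \<otimes> (h \<otimes> u)" using H_class_left_factor[OF H h(2) x] .
  obtain f where f: "f \<in> carrier G" "h = (h \<otimes> u) \<otimes> f"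
    using H_class_right_factor[OF H h(2) h(1)] .
  obtain g where g: "g \<in> carrier G" "h = g \<otimes> x" using H_class_left_factor[OF H x h(1)] .
  have "(x, x \<otimes> u) \<in> H_rel G"
  proof (rule H_relI)
    \<comment> \<open>The factor \<open>g\<close> takes \<open>x\<close> to \<open>h\<close>, so it
      takes \<open>x \<otimes> u\<close> to \<open>h \<otimes> u\<close>; from there
      \<open>e\<close> leads back to \<open>x\<close>.\<close>
    have "h \<otimes> u = g \<otimes> (x \<otimes> u)"
      using g uc xc by (metis m_assoc)
    then have "x = (e \<otimes> g) \<otimes> (x \<otimes> u)"
      using e g(1) uc xc by (metis m_assoc m_closed)
    then show "\<exists>c\<in>carrier G. x = c \<otimes> (x \<otimes> u)" using e(1) g(1) by blast
    have xu: "x \<otimes> u = c \<otimes> (h \<otimes> u)"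
      using c(1) hc uc unfolding c(2) by (rule m_assoc)
    have "x \<otimes> u = (c \<otimes> d) \<otimes> x"
      unfolding xu d(2) using c(1) d(1) xc by (rule m_assoc[symmetric])
    then show "\<exists>c\<in>carrier G. x \<otimes> u = c \<otimes> x" using c(1) d(1) by blast
    \<comment> \<open>The element \<open>f\<close> undoes \<open>u\<close> at \<open>h\<close>;
      multiplying by \<open>c\<close> on the left shows that it also undoes \<open>u\<close> at
      \<open>x\<close>.\<close>
    have "x = (c \<otimes> (h \<otimes> u)) \<otimes> f"
      using c f hc uc by (metis m_assoc m_closed)
    then have "x = (x \<otimes> u) \<otimes> f" unfolding xu .
    then show "\<exists>c\<in>carrier G. x = x \<otimes> u \<otimes> c" using f(1) by blast
  qed (use uc xc in auto)
  then show ?thesis using H_class_closed[OF H x] by blast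
qed

lemma twisting_const_on_H_class:
  assumes tw: "twisting G \<Phi>" and ti: "tight G \<Phi>" and H: "H \<in> H_classes G"
    and "a \<in> H" "b \<in> H" and u: "u \<in> carrier G"
  shows "\<Phi> a u = \<Phi> b u"
proof -
  have le: "\<Phi> a u \<le> \<Phi> b u" if a: "a \<in> H" and b: "b \<in> H" for a b
  proof -
    have ac: "a \<in> carrier G" using a H_class_subset[OF H] by auto
    obtain c where "c \<in> carrier G" "b = c \<otimes> a" using H_class_left_factor[OF H a b] .
    then obtain c' where c': "c' \<in> carrier G" "b = c' \<otimes> a" "\<Phi> c' a = 0"
      using ti ac unfolding tight_def by metis
    have "\<Phi> c' a + \<Phi> (c' \<otimes> a) u = \<Phi> c' (a \<otimes> u) + \<Phi> a u"
      using tw c'(1) ac u unfolding twisting_def by blast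
    then show ?thesis using c' by simp
  qed
  show ?thesis using le assms(4,5) by (simp add: le_antisym)
qed

end

section \<open>Coordinatewise maps and Schutzenberger groups\<close>

text \<open>The restriction to \<open>A \<times> B\<close> makes the map extensional, so that it can
  equal a \<open>right_translation\<close>, which is restricted too.\<close>

definition prod_map_on ::
  "'a set \<Rightarrow> 'b set \<Rightarrow> ('a \<Rightarrow> 'c) \<Rightarrow> ('b \<Rightarrow> 'd) \<Rightarrow> 'a \<times> 'b \<Rightarrow> 'c \<times> 'd" where
  "prod_map_on A B f g = (\<lambda>p\<in>A \<times> B. (f (fst p), g (snd p)))"

text \<open>The inner maps must stay inside \<open>A\<close> and \<open>B\<close>: at a pair outside
  \<open>A \<times> B\<close> the restricted outer map would be \<open>undefined\<close> as a whole
  instead of acting by coordinates.\<close>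

lemma compose_prod_map_on:
  assumes "f \<in> A \<rightarrow> A" "g \<in> B \<rightarrow> B"
  shows "compose (A \<times> B) (prod_map_on A B f' g') (prod_map_on A B f g)
    = prod_map_on A B (compose A f' f) (compose B g' g)"
  using assms by (auto simp: prod_map_on_def compose_def fun_eq_iff)

text \<open>Each coordinate is read off by fixing a point in the other factor, hence the
  nonemptiness; extensionality settles the values outside \<open>A\<close> and
  \<open>B\<close>.\<close>

lemma prod_map_on_inject:
  assumes "A \<noteq> {}" "B \<noteq> {}"
    and "f \<in> extensional A" "f' \<in> extensional A" "g \<in> extensional B" "g' \<in> extensional B"
    and eq: "prod_map_on A B f g = prod_map_on A B f' g'"
  shows "f = f' \<and> g = g'"
proof -
  have "f x = f' x \<and> g y = g' y" if "x \<in> A" "y \<in> B" for x y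
    using fun_cong[OF eq, of "(x, y)"] that by (simp add: prod_map_on_def)
  then show ?thesis using assms by (auto intro!: extensionalityI)
qed

lemma schutzenberger_group_PiE:
  assumes "monoid X" "H \<in> H_classes X" "f \<in> carrier (schutzenberger_group X H)"
  shows "f \<in> H \<rightarrow>\<^sub>E H"
  using assms monoid.right_stabilizers_mult_closed[OF assms(1,2)]
  by (auto simp: schutzenberger_group_def right_translation_def)

lemma schutzenberger_group_mult_closed:
  assumes "monoid X" and H: "H \<in> H_classes X"
    and "f \<in> carrier (schutzenberger_group X H)" "g \<in> carrier (schutzenberger_group X H)"
  shows "compose H g f \<in> carrier (schutzenberger_group X H)"
proof -
  interpret monoid X by fact
  obtain u v where u: "u \<in> right_stabilizers X H" "f = right_translation X H u"
    and v: "v \<in> right_stabilizers X H" "g = right_translation X H v"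
    using assms by (auto simp: schutzenberger_group_def)
  obtain h where h: "h \<in> H" using H_class_nonempty[OF H] by blast
  have uvc: "u \<in> carrier X" "v \<in> carrier X"
    using u v by (auto simp: right_stabilizers_def)
  have assoc: "x \<otimes>\<^bsub>X\<^esub> u \<otimes>\<^bsub>X\<^esub> v = x \<otimes>\<^bsub>X\<^esub> (u \<otimes>\<^bsub>X\<^esub> v)" if "x \<in> H" for x
    using that H_class_subset[OF H] uvc by (auto intro: m_assoc)
  have closed: "x \<otimes>\<^bsub>X\<^esub> u \<in> H" if "x \<in> H" for x
    using right_stabilizers_mult_closed[OF H u(1) that] .
  \<comment> \<open>The composite \<open>f\<close> then \<open>g\<close> is translation by
    \<open>u\<close> followed by \<open>v\<close>, so the candidate is the product in this order;
    one point of \<open>H\<close> kept in \<open>H\<close> is enough.\<close>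
  have "h \<otimes>\<^bsub>X\<^esub> (u \<otimes>\<^bsub>X\<^esub> v) \<in> H"
    using right_stabilizers_mult_closed[OF H v(1) closed[OF h]] assoc[OF h] by simp
  then have "u \<otimes>\<^bsub>X\<^esub> v \<in> right_stabilizers X H"
    using h uvc by (auto intro: right_stabilizersI)
  moreover have "compose H g f = right_translation X H (u \<otimes>\<^bsub>X\<^esub> v)"
    unfolding u v right_translation_def compose_def using closed assoc by auto
  ultimately show ?thesis by (auto simp: schutzenberger_group_def)
qed

section \<open>Translations in the twisted product\<close>

lemma twisted_translation:
  assumes M: "comm_monoid M" and "monoid S" and q: "q \<in> carrier M"
    and "twisting S \<Phi>" "tight S \<Phi>" and H: "H \<in> H_classes M" and H': "H' \<in> H_classes S"
    and i: "i \<in> carrier M" and u: "u \<in> carrier S" and a: "a \<in> H'"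
  shows "right_translation (twisted_product M q S \<Phi>) (H \<times> H') (i, u)
    = prod_map_on H H' (right_translation M H (i \<otimes>\<^bsub>M\<^esub> q [^]\<^bsub>M\<^esub> \<Phi> a u)) (right_translation S H' u)"
proof -
  interpret M: comm_monoid M by fact
  interpret S: monoid S by fact
  \<comment> \<open>The exponent of \<open>q\<close> is the same over all of \<open>H'\<close>, so
    the twist can be absorbed into the translating element of \<open>M\<close>.\<close>
  have "\<Phi> y u = \<Phi> a u" if "y \<in> H'" for y
    by (rule S.twisting_const_on_H_class[OF assms(4,5) H' that a u])
  moreover have "x \<in> carrier M" if "x \<in> H" for x using that H_class_subset[OF H] by blast
  ultimately show ?thesis
    using i q
    by (auto simp: right_translation_def prod_map_on_def twisted_product_def fun_eq_iff M.m_assoc)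
qed

lemma carrier_schutzenberger_twisted:
  assumes M: "comm_monoid M" and "monoid S" and q: "q \<in> carrier M"
    and "twisting S \<Phi>" and ti: "tight S \<Phi>" and H: "H \<in> H_classes M" and H': "H' \<in> H_classes S"
  shows "carrier (schutzenberger_group (twisted_product M q S \<Phi>) (H \<times> H'))
    = (\<lambda>(f, g). prod_map_on H H' f g)
        ` (carrier (schutzenberger_group M H) \<times> carrier (schutzenberger_group S H'))"
    (is "?L = ?F ` ?R")
proof -
  interpret M: comm_monoid M by fact
  interpret S: monoid S by fact
  let ?T = "twisted_product M q S \<Phi>"
  note trans = twisted_translation[OF assms]
  show ?thesis
  proof (intro equalityI subsetI)
    fix F assume "F \<in> ?L"
    then obtain i u where F: "F = right_translation ?T (H \<times> H') (i, u)"
      and iu: "(i, u) \<in> right_stabilizers ?T (H \<times> H')"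
      by (auto simp: schutzenberger_group_def)
    then obtain h a where ha: "h \<in> H" "a \<in> H'"
      and hai: "h \<otimes>\<^bsub>M\<^esub> i \<otimes>\<^bsub>M\<^esub> q [^]\<^bsub>M\<^esub> \<Phi> a u \<in> H" and au: "a \<otimes>\<^bsub>S\<^esub> u \<in> H'"
      and i: "i \<in> carrier M" and u: "u \<in> carrier S"
      unfolding right_stabilizers_iff by (auto simp: twisted_product_def)
    \<comment> \<open>The shift of \<open>i\<close> is evaluated at the witness \<open>a\<close>
      itself, which is then also the base point given to \<open>trans\<close>.\<close>
    have "h \<otimes>\<^bsub>M\<^esub> (i \<otimes>\<^bsub>M\<^esub> q [^]\<^bsub>M\<^esub> \<Phi> a u) \<in> H"
      using hai ha i q H_class_subset[OF H] by (auto simp: M.m_assoc subset_iff)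
    then have "i \<otimes>\<^bsub>M\<^esub> q [^]\<^bsub>M\<^esub> \<Phi> a u \<in> right_stabilizers M H"
      using ha i q by (auto intro: right_stabilizersI)
    moreover have "u \<in> right_stabilizers S H'"
      using ha au u by (auto intro: right_stabilizersI)
    ultimately show "F \<in> ?F ` ?R"
      unfolding F trans[OF i u ha(2)] by (auto simp: schutzenberger_group_def)
  next
    fix F assume "F \<in> ?F ` ?R"
    then obtain j u where F: "F = prod_map_on H H' (right_translation M H j) (right_translation S H' u)"
      and j: "j \<in> right_stabilizers M H" and u: "u \<in> right_stabilizers S H'"
      by (auto simp: schutzenberger_group_def)
    have jc: "j \<in> carrier M" and uc: "u \<in> carrier S"
      using j u by (auto simp: right_stabilizers_def)
    obtain h a where ha: "h \<in> H" "a \<in> H'"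
      using H_class_nonempty[OF H] H_class_nonempty[OF H'] by blast
    have hc: "h \<in> carrier M" and ac: "a \<in> carrier S"
      using ha H_class_subset[OF H] H_class_subset[OF H'] by auto
    \<comment> \<open>The second half of tightness removes the twist at \<open>a\<close>, so that
      \<open>j\<close> needs no correction, which could not be subtracted in
      \<open>M\<close>.\<close>
    obtain u' where u': "u' \<in> carrier S" "a \<otimes>\<^bsub>S\<^esub> u = a \<otimes>\<^bsub>S\<^esub> u'" "\<Phi> a u' = 0"
      using ti ac uc unfolding tight_def by metis
    \<comment> \<open>Agreement of \<open>u\<close> and \<open>u'\<close> at the single point
      \<open>a\<close> forces agreement on \<open>H'\<close>.\<close>
    have "right_translation S H' u = right_translation S H' u'"
      unfolding right_translation_def
      using S.H_class_translation_eq[OF H' ha(2) _ uc u'(1,2)] by (intro restrict_ext)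
    then have "F = right_translation ?T (H \<times> H') (j, u')"
      unfolding F trans[OF jc u'(1) ha(2)] using u' jc by simp
    moreover have "(j, u') \<in> right_stabilizers ?T (H \<times> H')"
    proof (rule right_stabilizersI[where h = "(h, a)"])
      show "(h, a) \<otimes>\<^bsub>?T\<^esub> (j, u') \<in> H \<times> H'"
        using M.right_stabilizers_mult_closed[OF H j ha(1)]
          S.right_stabilizers_mult_closed[OF H' u ha(2)] u' hc jc
        by (auto simp: twisted_product_def)
    qed (use ha jc u' in \<open>auto simp: twisted_product_def\<close>)
    ultimately show "F \<in> ?L" by (auto simp: schutzenberger_group_def)
  qed
qed

section \<open>Assembling the isomorphism\<close>

text \<open>The natural map runs from the direct product to the group of the twisted product,
  against the direction of the theorem. Closure of \<open>G\<close> under its product is what lets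
  the inverse bijection respect multiplication.\<close>

lemma is_iso_if_inverse_iso:
  assumes phi: "\<phi> \<in> iso G K"
    and closed: "\<And>x y. \<lbrakk>x \<in> carrier G; y \<in> carrier G\<rbrakk> \<Longrightarrow> x \<otimes>\<^bsub>G\<^esub> y \<in> carrier G"
  shows "K \<cong> G"
proof -
  have bij: "bij_betw \<phi> (carrier G) (carrier K)" and hom: "\<phi> \<in> hom G K"
    using phi by (auto simp: iso_def)
  let ?\<psi> = "inv_into (carrier G) \<phi>"
  have "?\<psi> \<in> hom K G"
  proof (rule homI)
    fix x y assume x: "x \<in> carrier K" and y: "y \<in> carrier K"
    have inG: "?\<psi> x \<in> carrier G" "?\<psi> y \<in> carrier G"
      using x y bij by (auto simp: bij_betw_def intro: inv_into_into)
    \<comment> \<open>Both sides of the homomorphism law for \<open>?\<psi>\<close> are compared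
      through their images under \<open>\<phi>\<close>.\<close>
    then have "\<phi> (?\<psi> x \<otimes>\<^bsub>G\<^esub> ?\<psi> y) = x \<otimes>\<^bsub>K\<^esub> y"
      using hom_mult[OF hom inG] x y bij by (simp add: bij_betw_inv_into_right)
    then show "?\<psi> (x \<otimes>\<^bsub>K\<^esub> y) = ?\<psi> x \<otimes>\<^bsub>G\<^esub> ?\<psi> y"
      using bij_betw_inv_into_left[OF bij closed[OF inG]] by simp
  qed (use bij in \<open>auto simp: bij_betw_def intro: inv_into_into\<close>)
  then show ?thesis
    using bij_betw_inv_into[OF bij] by (auto simp: is_iso_def iso_def)
qed

theorem theorem6p8:
  fixes M :: "('m, 'x) monoid_scheme"
    and S :: "('s, 'y) monoid_scheme"
    and q :: 'm
    and \<Phi> :: "'s \<Rightarrow> 's \<Rightarrow> nat"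
    and H :: "'m set"
    and H' :: "'s set"
  assumes "comm_monoid M"
    and "monoid S"
    and "q \<in> carrier M"
    and "twisting S \<Phi>"
    and "tight S \<Phi>"
    and "H \<in> H_classes M"
    and "H' \<in> H_classes S"
    and "H \<times> H' \<in> H_classes (twisted_product M q S \<Phi>)"
  shows "schutzenberger_group (twisted_product M q S \<Phi>) (H \<times> H')
           \<cong> schutzenberger_group M H \<times>\<times> schutzenberger_group S H'"
proof (rule is_iso_if_inverse_iso)
  let ?T = "twisted_product M q S \<Phi>"
  let ?A = "schutzenberger_group M H" and ?B = "schutzenberger_group S H'"
  let ?F = "\<lambda>(f, g). prod_map_on H H' f g"
  have M: "monoid M" using assms(1) by (simp add: comm_monoid.axioms)
  have A: "f \<in> H \<rightarrow>\<^sub>E H" if "f \<in> carrier ?A" for f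
    using schutzenberger_group_PiE[OF M assms(6) that] .
  have B: "g \<in> H' \<rightarrow>\<^sub>E H'" if "g \<in> carrier ?B" for g
    using schutzenberger_group_PiE[OF assms(2,7) that] .
  have carrier: "carrier (schutzenberger_group ?T (H \<times> H')) = ?F ` (carrier ?A \<times> carrier ?B)"
    by (rule carrier_schutzenberger_twisted[OF assms(1-7)])
  \<comment> \<open>Translations are extensional and \<H>-classes are nonempty, so the coordinates
    can be recovered; surjectivity is the equation \<open>carrier\<close>.\<close>
  have "inj_on ?F (carrier ?A \<times> carrier ?B)"
    unfolding inj_on_def
    using prod_map_on_inject[OF H_class_nonempty[OF assms(6)] H_class_nonempty[OF assms(7)]] A B
    by (auto simp: PiE_def) blast+
  \<comment> \<open>All three products apply the first factor first, and composition is
    coordinatewise because the translations map \<open>H\<close> and \<open>H'\<close> to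
    themselves.\<close>
  moreover have "?F \<in> hom (?A \<times>\<times> ?B) (schutzenberger_group ?T (H \<times> H'))"
  proof (rule homI)
    fix x y assume "x \<in> carrier (?A \<times>\<times> ?B)" "y \<in> carrier (?A \<times>\<times> ?B)"
    then show "?F (x \<otimes>\<^bsub>?A \<times>\<times> ?B\<^esub> y) = ?F x \<otimes>\<^bsub>schutzenberger_group ?T (H \<times> H')\<^esub> ?F y"
      using A B
      by (auto simp: DirProd_def schutzenberger_group_def PiE_def compose_prod_map_on)
  qed (auto simp: carrier)
  ultimately show "?F \<in> iso (?A \<times>\<times> ?B) (schutzenberger_group ?T (H \<times> H'))"
    by (auto simp: iso_def bij_betw_def carrier)
  show "x \<otimes>\<^bsub>?A \<times>\<times> ?B\<^esub> y \<in> carrier (?A \<times>\<times> ?B)"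
    if "x \<in> carrier (?A \<times>\<times> ?B)" "y \<in> carrier (?A \<times>\<times> ?B)" for x y
    using that schutzenberger_group_mult_closed[OF M assms(6)]
      schutzenberger_group_mult_closed[OF assms(2,7)]
    by (auto simp: DirProd_def) (auto simp: schutzenberger_group_def)
qed

end
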